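(* Let $N\ge 2$ and let $\mathbf Q=\sum_{\emptyset\ne I\subseteq[N]}Q_I S_I$ with $Q_I\in\mathbb{Q}$ be a balanced information quantity, i.e. $\sum_{I\ni \ell}Q_I=0$ for every $\ell\in[N]$. Then $\mathbf Q$ is finite and scheme-independent in QFT when evaluated on any disjoint configuration: for every disjoint configuration $A_1,\dots,A_N$ in a state of a QFT with regulated entropies $S_\epsilon(A_I)$, the limit $\lim_{\epsilon\to0}\sum_I Q_I\,S_\epsilon(A_I)$ exists, is finite, and does not depend on the regularization scheme.
   Context: $[N]=\{1,\dots,N\}$. A configuration consists of $N$ spatial subsystems $A_1,\dots,A_N$ on a Cauchy slice, each a finite union of disjoint connected closed regions $A_\ell^i$; it is disjoint if all regions are pairwise non-intersecting (including their boundaries): $A_{\ell_1}^{i_1}\cap A_{\ell_2}^{i_2}=\emptyset$ for $(\ell_1,i_1)\ne(\ell_2,i_2)$. For nonempty $I\subseteq[N]$, $A_I=\bigcup_{\ell\in I}A_\ell$. For each regularization scheme and each value of the regulator $\epsilon>0$, $S_\epsilon(A_I)\in\mathbb{R}$ denotes the regulated von Neumann entropy of the reduced density matrix on $A_I$; it may diverge as $\epsilon\to0$ and may depend on the scheme. The QFT input (standing fact): for a disjoint configuration, every instance of the mutual information is finite and scheme-independent, i.e. for all nonempty disjoint $J,K\subset[N]$ the limit $\lim_{\epsilon\to0}\big[S_\epsilon(A_J)+S_\epsilon(A_K)-S_\epsilon(A_{J\cup K})\big]$ exists, is finite, and is the same for all schemes. *)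

theory Defs
  imports "HOL-Analysis.Analysis"
begin

text \<open>
  A configuration is a function \<open>A\<close> sending each label \<open>l \<in> {1..N}\<close> to the list of regions whose
  union is the \<open>l\<close>-th subsystem; list positions play the role of the superscript \<open>i\<close>.
  The Cauchy slice is an arbitrary topological space \<open>X\<close>.  Regions, and the subsystems made of
  them, are taken to be nonempty.
\<close>

definition region :: "'x topology \<Rightarrow> 'x set \<Rightarrow> bool" where
  "region X C \<longleftrightarrow> C \<noteq> {} \<and> closedin X C \<and> connectedin X C"

definition configuration :: "'x topology \<Rightarrow> nat \<Rightarrow> (nat \<Rightarrow> 'x set list) \<Rightarrow> bool" where
  "configuration X N A \<longleftrightarrow>
     (\<forall>l\<in>{1..N}. A l \<noteq> [] \<and> (\<forall>C\<in>set (A l). region X C) \<and>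
        (\<forall>i<length (A l). \<forall>j<length (A l). i \<noteq> j \<longrightarrow> A l ! i \<inter> A l ! j = {}))"

text \<open>Regions are closed, so they contain their boundaries.\<close>

definition disjoint_configuration :: "'x topology \<Rightarrow> nat \<Rightarrow> (nat \<Rightarrow> 'x set list) \<Rightarrow> bool" where
  "disjoint_configuration X N A \<longleftrightarrow> configuration X N A \<and>
     (\<forall>l1\<in>{1..N}. \<forall>l2\<in>{1..N}. \<forall>i1<length (A l1). \<forall>i2<length (A l2).
        (l1, i1) \<noteq> (l2, i2) \<longrightarrow> A l1 ! i1 \<inter> A l2 ! i2 = {})"

definition subsystem :: "(nat \<Rightarrow> 'x set list) \<Rightarrow> nat \<Rightarrow> 'x set" where
  "subsystem A l = \<Union>(set (A l))"

definition joint_subsystem :: "(nat \<Rightarrow> 'x set list) \<Rightarrow> nat set \<Rightarrow> 'x set" where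
  "joint_subsystem A I = (\<Union>l\<in>I. subsystem A l)"

text \<open>
  \<open>S r e B\<close> is the regulated entropy, in a given state of the QFT, of the spatial region \<open>B\<close> in the
  regularization scheme \<open>r\<close> at regulator value \<open>e > 0\<close>.  A family \<open>f r e\<close> of regulated quantities
  is finite and scheme-independent if all schemes have one and the same real limit as \<open>e\<close>
  tends to \<open>0\<close> from above.
\<close>

type_synonym ('r, 'x) regulated_entropy = "'r \<Rightarrow> real \<Rightarrow> 'x set \<Rightarrow> real"

definition finite_scheme_independent :: "('r \<Rightarrow> real \<Rightarrow> real) \<Rightarrow> bool" where
  "finite_scheme_independent f \<longleftrightarrow> (\<exists>L::real. \<forall>r. (f r \<longlongrightarrow> L) (at_right 0))"

definition mutual_information ::
  "('r, 'x) regulated_entropy \<Rightarrow> (nat \<Rightarrow> 'x set list) \<Rightarrow> nat set \<Rightarrow> nat set \<Rightarrow> 'r \<Rightarrow> real \<Rightarrow> real" where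
  "mutual_information S A J K r e =
     S r e (joint_subsystem A J) + S r e (joint_subsystem A K) - S r e (joint_subsystem A (J \<union> K))"

text \<open>The physical input: mutual informations of disjoint configurations are well defined.\<close>

definition mutual_information_finite ::
  "'x topology \<Rightarrow> nat \<Rightarrow> ('r, 'x) regulated_entropy \<Rightarrow> bool" where
  "mutual_information_finite X N S \<longleftrightarrow>
     (\<forall>A J K. disjoint_configuration X N A \<longrightarrow>
        J \<subseteq> {1..N} \<longrightarrow> K \<subseteq> {1..N} \<longrightarrow> J \<noteq> {} \<longrightarrow> K \<noteq> {} \<longrightarrow> J \<inter> K = {} \<longrightarrow>
        finite_scheme_independent (mutual_information S A J K))"

text \<open>
  An information quantity is given by its coefficients \<open>Q I\<close>; only the values at nonempty
  \<open>I \<subseteq> {1..N}\<close> matter.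
\<close>

definition information_quantity ::
  "nat \<Rightarrow> (nat set \<Rightarrow> rat) \<Rightarrow> ('r, 'x) regulated_entropy \<Rightarrow> (nat \<Rightarrow> 'x set list) \<Rightarrow> 'r \<Rightarrow> real \<Rightarrow> real" where
  "information_quantity N Q S A r e =
     (\<Sum>I | I \<noteq> {} \<and> I \<subseteq> {1..N}. of_rat (Q I) * S r e (joint_subsystem A I))"

definition balanced :: "nat \<Rightarrow> (nat set \<Rightarrow> rat) \<Rightarrow> bool" where
  "balanced N Q \<longleftrightarrow> (\<forall>l\<in>{1..N}. (\<Sum>I | I \<subseteq> {1..N} \<and> l \<in> I. Q I) = 0)"

end

theory Submission
  imports Defs
begin

text \<open>
  Balance says that the single-party entropies drop out, so every \<open>S\<^sub>I\<close> may be replaced by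
  \<open>S\<^sub>I - (\<Sum>l\<in>I. S\<^sub>l)\<close>.  Splitting off one party at a time writes this difference as minus a sum of
  mutual informations, so it is finite and scheme-independent, and so are rational combinations.
\<close>

lemma finite_scheme_independent_diff:
  assumes "finite_scheme_independent f" and "finite_scheme_independent g"
  shows "finite_scheme_independent (\<lambda>r e. f r e - g r e)"
  using assms unfolding finite_scheme_independent_def by (blast intro: tendsto_diff)

lemma finite_scheme_independent_lincomb:
  assumes "\<And>i. i \<in> I \<Longrightarrow> finite_scheme_independent (f i)"
  shows "finite_scheme_independent (\<lambda>r e. \<Sum>i\<in>I. c i * f i r e)"
proof -
  \<comment> \<open>Each \<open>L i\<close> is chosen before the scheme \<open>r\<close>, so the
    limit \<open>\<Sum>i\<in>I. c i * L i\<close> below is common to all schemes.\<close>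
  obtain L where "\<And>i r. i \<in> I \<Longrightarrow> (f i r \<longlongrightarrow> L i) (at_right 0)"
    using assms unfolding finite_scheme_independent_def by metis
  then have "((\<lambda>e. \<Sum>i\<in>I. c i * f i r e) \<longlongrightarrow> (\<Sum>i\<in>I. c i * L i)) (at_right 0)" for r
    by (intro tendsto_sum tendsto_mult_left)
  then show ?thesis
    unfolding finite_scheme_independent_def by blast
qed

lemma finite_scheme_independent_entropy_excess:
  assumes "mutual_information_finite X N S" and "disjoint_configuration X N A"
    and "I \<noteq> {}" and "I \<subseteq> {1..N}"
  shows "finite_scheme_independent
    (\<lambda>r e. S r e (joint_subsystem A I) - (\<Sum>l\<in>I. S r e (joint_subsystem A {l})))"
proof -
  have "finite I"
    using assms(4) finite_subset by blast
  then show ?thesis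
    using assms(3,4)
  \<comment> \<open>Starting from singletons, where the excess is identically 0, keeps
    \<open>I\<close> nonempty, as the mutual information hypothesis demands of both
    arguments.\<close>
  proof (induction I rule: finite_ne_induct)
    case (singleton l)
    show ?case
      by (auto simp: finite_scheme_independent_def)
  next
    case (insert k I)
    have "finite_scheme_independent (mutual_information S A {k} I)"
      using assms(1,2) insert.hyps insert.prems unfolding mutual_information_finite_def by auto
    \<comment> \<open>The excess of \<open>insert k I\<close> is that of \<open>I\<close> minus the
      mutual information of \<open>{k}\<close> and \<open>I\<close>: the two copies of the entropy
      of \<open>I\<close> cancel.\<close>
    from finite_scheme_independent_diff[OF insert.IH this] show ?case
      using insert by (simp add: mutual_information_def algebra_simps)
  qed
qed

text \<open>Exchanging the two sums collects, as the coefficient of each \<open>s l\<close>, exactly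
  the sum that balance sets to 0.\<close>

lemma balanced_sum_singletons:
  fixes s :: "nat \<Rightarrow> real"
  assumes "balanced N Q"
  shows "(\<Sum>I | I \<noteq> {} \<and> I \<subseteq> {1..N}. of_rat (Q I) * (\<Sum>l\<in>I. s l)) = 0"
proof -
  let ?P = "{I. I \<noteq> {} \<and> I \<subseteq> {1..N}}"
  have fin: "finite ?P"
    by (rule finite_subset[of _ "Pow {1..N}"]) auto
  have "(\<Sum>I\<in>?P. of_rat (Q I) * (\<Sum>l\<in>I. s l))
      = (\<Sum>I\<in>?P. \<Sum>l | l \<in> {1..N} \<and> l \<in> I. of_rat (Q I) * s l)"
    by (auto simp: sum_distrib_left intro!: sum.cong)
  also have "\<dots> = (\<Sum>l\<in>{1..N}. \<Sum>I | I \<in> ?P \<and> l \<in> I. of_rat (Q I) * s l)"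
    using fin by (rule sum.swap_restrict) simp
  \<comment> \<open>A set containing \<open>l\<close> is nonempty, so the inner index set is the one
    in \<open>balanced\<close>.\<close>
  also have "\<dots> = (\<Sum>l\<in>{1..N}. of_rat (\<Sum>I | I \<subseteq> {1..N} \<and> l \<in> I. Q I) * s l)"
    by (auto simp: of_rat_sum sum_distrib_right intro!: sum.cong)
  also have "\<dots> = 0"
    using assms by (simp add: balanced_def)
  finally show ?thesis .
qed

theorem lemma4p1:
  fixes N :: nat
    and Q :: "nat set \<Rightarrow> rat"
    and X :: "'x topology"
    and S :: "('r, 'x) regulated_entropy"
    and A :: "nat \<Rightarrow> 'x set list"
  assumes "N \<ge> 2"
    and "balanced N Q"
    and "mutual_information_finite X N S"
    and "disjoint_configuration X N A"
  shows "finite_scheme_independent (information_quantity N Q S A)"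
proof -
  let ?D = "\<lambda>I r e. S r e (joint_subsystem A I) - (\<Sum>l\<in>I. S r e (joint_subsystem A {l}))"
  \<comment> \<open>This equality is exact for every \<open>r\<close> and \<open>e\<close>: the
    single-party terms cancel before any limit is taken, although each may diverge.\<close>
  have "information_quantity N Q S A
      = (\<lambda>r e. \<Sum>I | I \<noteq> {} \<and> I \<subseteq> {1..N}. of_rat (Q I) * ?D I r e)"
    using balanced_sum_singletons[OF assms(2)]
    by (simp add: fun_eq_iff information_quantity_def right_diff_distrib sum_subtractf)
  moreover have "finite_scheme_independent
      (\<lambda>r e. \<Sum>I | I \<noteq> {} \<and> I \<subseteq> {1..N}. of_rat (Q I) * ?D I r e)"
    using finite_scheme_independent_entropy_excess[OF assms(3,4)]
    by (intro finite_scheme_independent_lincomb) auto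
  ultimately show ?thesis
    by simp
qed

end
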